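(* Let $\mathcal{A}$ be a finite alphabet. The shift map commutes with $n$-fold interleaving closure: for each $n\ge1$ and a general set $X\subseteq\mathcal{A}^{\mathbb{N}}$, $$S(X^{[n]})=(SX)^{[n]}.$$
   Context: $\mathbb{N}=\{0,1,2,\dots\}$. The shift is $S(a_0a_1a_2\cdots)=a_1a_2a_3\cdots$, applied elementwise to sets. For $\mathbf{x}=a_0a_1a_2\cdots\in\mathcal{A}^{\mathbb{N}}$, $i\ge0$, $n\ge1$, the decimation is $\psi_{i,n}(\mathbf{x})=a_ia_{i+n}a_{i+2n}\cdots$, and $\psi_{i,n}(X)=\{\psi_{i,n}(\mathbf{x}):\mathbf{x}\in X\}$. The $n$-fold interleaving of sequences $\mathbf{x}_i=a_{i,0}a_{i,1}\cdots$ ($0\le i\le n-1$) is $b_0b_1b_2\cdots$ with $b_{i+jn}=a_{i,j}$ ($0\le i\le n-1$, $j\ge0$); the $n$-fold interleaving $(\circledast_n)_{i=0}^{n-1}X_i$ of sets is the set of all $n$-fold interleavings of $(\mathbf{x}_0,\dots,\mathbf{x}_{n-1})$ with $\mathbf{x}_i\in X_i$. The $n$-fold interleaving closure of $X$ is $X^{[n]}=(\circledast_n)_{i=0}^{n-1}\psi_{i,n}(X)$. *)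

theory Defs
  imports Main "HOL-Library.FuncSet"
begin

definition seq_shift :: "(nat \<Rightarrow> 'a) \<Rightarrow> nat \<Rightarrow> 'a" where
  "seq_shift x = (\<lambda>k. x (Suc k))"

definition decimation :: "nat \<Rightarrow> nat \<Rightarrow> (nat \<Rightarrow> 'a) \<Rightarrow> nat \<Rightarrow> 'a" where
  "decimation i n x = (\<lambda>j. x (i + j * n))"

text \<open>Only the sequences \<open>x i\<close> with \<open>i < n\<close> matter, and \<open>n \<ge> 1\<close> is intended. The two lemmas
  below show that, for \<open>n \<ge> 1\<close>, \<open>interleave n x\<close> is the unique sequence \<open>b\<close> with
  \<open>b (i + j * n) = x i j\<close> for all \<open>i < n\<close> and all \<open>j\<close>.\<close>

definition interleave :: "nat \<Rightarrow> (nat \<Rightarrow> nat \<Rightarrow> 'a) \<Rightarrow> nat \<Rightarrow> 'a" where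
  "interleave n x = (\<lambda>k. x (k mod n) (k div n))"

lemma interleave_apply: "i < n \<Longrightarrow> interleave n x (i + j * n) = x i j"
  by (simp add: interleave_def)

lemma interleave_unique:
  assumes "n \<ge> 1" and "\<And>i j. i < n \<Longrightarrow> b (i + j * n) = x i j"
  shows "b = interleave n x"
proof
  fix k
  have "b (k mod n + (k div n) * n) = x (k mod n) (k div n)"
    using assms(1) by (intro assms(2)) simp
  then show "b k = interleave n x k"
    by (simp add: interleave_def)
qed

definition interleave_sets :: "nat \<Rightarrow> (nat \<Rightarrow> (nat \<Rightarrow> 'a) set) \<Rightarrow> (nat \<Rightarrow> 'a) set" where
  "interleave_sets n X = {interleave n x | x. \<forall>i<n. x i \<in> X i}"

definition interleaving_closure :: "nat \<Rightarrow> (nat \<Rightarrow> 'a) set \<Rightarrow> (nat \<Rightarrow> 'a) set" where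
  "interleaving_closure n X = interleave_sets n (\<lambda>i. decimation i n ` X)"

end

theory Submission
  imports Defs
begin

text \<open>A sequence lies in the closure iff along every residue class modulo \<open>n\<close> it agrees with some
  member of \<open>X\<close>. The shift permutes the residue classes cyclically; the only entry lost is
  entry 0, which is recovered from the witness for the class of \<open>n - 1\<close> in the shifted sequence.\<close>

lemma mem_interleaving_closure_iff:
  assumes "n \<ge> 1"
  shows "b \<in> interleaving_closure n X \<longleftrightarrow> (\<forall>i<n. \<exists>x\<in>X. \<forall>j. b (i + j * n) = x (i + j * n))"
    (is "_ \<longleftrightarrow> ?R")
proof
  assume "b \<in> interleaving_closure n X"
  then obtain y where b: "b = interleave n y" and y: "\<forall>i<n. y i \<in> decimation i n ` X"
    by (auto simp: interleaving_closure_def interleave_sets_def)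
  show ?R
  proof (intro allI impI)
    fix i assume i: "i < n"
    with y obtain x where "x \<in> X" "y i = decimation i n x" by blast
    with b i show "\<exists>x\<in>X. \<forall>j. b (i + j * n) = x (i + j * n)"
      by (auto simp: interleave_apply decimation_def)
  qed
next
  assume ?R
  then have "\<forall>i<n. decimation i n b \<in> decimation i n ` X"
    by (auto simp: decimation_def)
  moreover have "b = interleave n (\<lambda>i. decimation i n b)"
    using assms by (rule interleave_unique) (simp add: decimation_def)
  ultimately show "b \<in> interleaving_closure n X"
    unfolding interleaving_closure_def interleave_sets_def by blast
qed

text \<open>The progression from \<open>i\<close> is a tail of the residue class of
  \<open>i mod n\<close>, so the witness for that class serves. Having no bound on \<open>i\<close>
  spares a case split where the shift moves \<open>n - 1\<close> to \<open>n\<close>.\<close>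

lemma interleaving_closure_agrees:
  assumes "n \<ge> 1" and "b \<in> interleaving_closure n X"
  shows "\<exists>x\<in>X. \<forall>j. b (i + j * n) = x (i + j * n)"
proof -
  have "i mod n < n" using assms(1) by simp
  then obtain x where "x \<in> X" and x: "\<And>j. b (i mod n + j * n) = x (i mod n + j * n)"
    using assms by (metis mem_interleaving_closure_iff)
  \<comment> \<open>Division with remainder gives
    \<open>i + j * n = i mod n + (i div n + j) * n\<close>.\<close>
  have "b (i + j * n) = x (i + j * n)" for j
    using x[of "i div n + j"] by (simp add: add_mult_distrib flip: add.assoc)
  with \<open>x \<in> X\<close> show ?thesis by blast
qed

theorem proposition4p11:
  fixes A :: "'a set" and X :: "(nat \<Rightarrow> 'a) set" and n :: nat
  assumes "finite A" and "X \<subseteq> UNIV \<rightarrow> A" and "n \<ge> 1"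
  shows "seq_shift ` interleaving_closure n X = interleaving_closure n (seq_shift ` X)"
proof (intro equalityI subsetI)
  fix c assume "c \<in> seq_shift ` interleaving_closure n X"
  then obtain b where b: "b \<in> interleaving_closure n X" and c: "c = seq_shift b" by blast
  \<comment> \<open>The progression from \<open>i\<close> in \<open>c\<close> is the one from
    \<open>Suc i\<close> in \<open>b\<close>; for \<open>i = n - 1\<close> it starts at
    \<open>n\<close>, outside the range of the membership criterion.\<close>
  have "\<exists>x\<in>X. \<forall>j. c (i + j * n) = seq_shift x (i + j * n)" for i
    using interleaving_closure_agrees[OF assms(3) b, of "Suc i"] by (simp add: c seq_shift_def)
  then show "c \<in> interleaving_closure n (seq_shift ` X)"
    by (simp add: mem_interleaving_closure_iff[OF assms(3)])
next
  fix c assume "c \<in> interleaving_closure n (seq_shift ` X)"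
  then have c: "\<exists>x\<in>X. \<forall>j. c (i + j * n) = x (Suc (i + j * n))" for i
    using interleaving_closure_agrees[OF assms(3), of c "seq_shift ` X" i]
    by (simp add: seq_shift_def)
  from c[of "n - 1"] obtain z where "z \<in> X"
    and z: "\<And>j. c (n - 1 + j * n) = z (Suc (n - 1 + j * n))" by blast
  \<comment> \<open>The entries of \<open>c\<close> governed by \<open>z\<close> move to the
    positive multiples of \<open>n\<close> in \<open>b\<close>; prepending \<open>z 0\<close>
    extends the agreement with \<open>z\<close> to position 0.\<close>
  define b where "b = case_nat (z 0) c"
  have "\<exists>x\<in>X. \<forall>j. b (i + j * n) = x (i + j * n)" for i
  proof (cases i)
    case 0
    have "b (j * n) = z (j * n)" for j
    proof (cases j)
      case (Suc k)
      \<comment> \<open>Since \<open>n \<ge> 1\<close>, the truncated subtraction is exact.\<close>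
      then have "j * n = Suc (n - 1 + k * n)" using assms(3) by simp
      then show ?thesis using z[of k] by (simp add: b_def)
    qed (simp add: b_def)
    with 0 \<open>z \<in> X\<close> show ?thesis by auto
  next
    case (Suc k)
    then show ?thesis using c[of k] by (simp add: b_def)
  qed
  then have "b \<in> interleaving_closure n X"
    by (simp add: mem_interleaving_closure_iff[OF assms(3)])
  moreover have "c = seq_shift b" by (simp add: b_def seq_shift_def)
  ultimately show "c \<in> seq_shift ` interleaving_closure n X" by blast
qed

end
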